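(* Let $d\ge 8$ and let $P_d$ be the graph obtained from $K_{d+1}$ by deleting the edges of three pairwise vertex-disjoint paths of length 2 and then deleting the edges of a maximum matching on the $d-8$ vertices not on these paths (so exactly three vertices of $P_d$, the middle vertices of the deleted paths, have degree $d-2$). Let $G_d$ be any graph obtained from a copy of $K_{d-3}$ by adding pairwise vertex-disjoint copies of $P_d$, where for each copy one edge is added from each of its three vertices of degree $d-2$ to some vertex of the $K_{d-3}$, there are no edges between distinct copies, and enough copies are added so that every vertex of the $K_{d-3}$ has degree at least $d-1$. Then $G_d$ has minimum degree $d-1$ and has no immersion of $K_d$.
   Context: A graph $H$ is immersed in a graph $G$ if there is an injection $\phi:V(H)\to V(G)$ and an assignment to each edge $uv\in E(H)$ of a path in $G$ between $\phi(u)$ and $\phi(v)$ with paths of distinct edges pairwise edge-disjoint. *)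

theory Defs
  imports Main "HOL-Library.Disjoint_Sets"
begin

text \<open>An undirected graph is given by its vertex set and its set of edges, an edge being the
  two-element set of its ends.  All graphs below are built from complete graphs and their
  isomorphic copies, so they are simple by construction.\<close>

record 'a ugraph =
  verts :: "'a set"
  edges :: "'a set set"

definition complete_on :: "'a set \<Rightarrow> 'a ugraph" where
  "complete_on V = \<lparr>verts = V, edges = {{u, v} | u v. u \<in> V \<and> v \<in> V \<and> u \<noteq> v}\<rparr>"

definition complete_graph :: "nat \<Rightarrow> nat ugraph" where
  "complete_graph n = complete_on {..<n}"

definition degree :: "'a ugraph \<Rightarrow> 'a \<Rightarrow> nat" where
  "degree G v = card {e \<in> edges G. v \<in> e}"

definition min_degree :: "'a ugraph \<Rightarrow> nat" where
  "min_degree G = Min (degree G ` verts G)"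

definition isomorphic :: "'a ugraph \<Rightarrow> 'b ugraph \<Rightarrow> bool" where
  "isomorphic G H \<longleftrightarrow>
     (\<exists>f. bij_betw f (verts G) (verts H) \<and> edges H = (\<lambda>e. f ` e) ` edges G)"

text \<open>A path is represented by the list of its vertices, so a path of length \<open>k\<close> is a list with
  \<open>k + 1\<close> entries.\<close>

definition path_edges :: "'a list \<Rightarrow> 'a set set" where
  "path_edges p = {{p ! i, p ! Suc i} | i. Suc i < length p}"

definition is_path :: "'a ugraph \<Rightarrow> 'a list \<Rightarrow> bool" where
  "is_path G p \<longleftrightarrow> p \<noteq> [] \<and> distinct p \<and> set p \<subseteq> verts G \<and> path_edges p \<subseteq> edges G"

text \<open>Paths are undirected: the list may be traversed from either end.\<close>

definition path_between :: "'a ugraph \<Rightarrow> 'a \<Rightarrow> 'a \<Rightarrow> 'a list \<Rightarrow> bool" where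
  "path_between G u v p \<longleftrightarrow> is_path G p \<and> {hd p, last p} = {u, v}"

definition immersed :: "'a ugraph \<Rightarrow> 'b ugraph \<Rightarrow> bool" where
  "immersed H G \<longleftrightarrow>
     (\<exists>\<phi> \<pi>. inj_on \<phi> (verts H) \<and> \<phi> ` verts H \<subseteq> verts G \<and>
            (\<forall>u v. {u, v} \<in> edges H \<longrightarrow> path_between G (\<phi> u) (\<phi> v) (\<pi> {u, v})) \<and>
            disjoint_family_on (\<lambda>e. path_edges (\<pi> e)) (edges H))"

definition matching :: "'a ugraph \<Rightarrow> 'a set set \<Rightarrow> bool" where
  "matching G M \<longleftrightarrow> M \<subseteq> edges G \<and> disjoint M"

definition maximum_matching :: "'a ugraph \<Rightarrow> 'a set set \<Rightarrow> bool" where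
  "maximum_matching G M \<longleftrightarrow> matching G M \<and> (\<forall>M'. matching G M' \<longrightarrow> card M' \<le> card M)"

text \<open>\<open>is_P d P\<close>: the graph \<open>P\<close> arises from a complete graph on \<open>d + 1\<close> vertices by the
  construction of \<open>P\<^sub>d\<close>; this determines \<open>P\<close> up to isomorphism.\<close>

definition is_P :: "nat \<Rightarrow> 'a ugraph \<Rightarrow> bool" where
  "is_P d P \<longleftrightarrow>
     (\<exists>V p M. finite V \<and> card V = d + 1 \<and>
        (\<forall>i<3::nat. is_path (complete_on V) (p i) \<and> length (p i) = 3) \<and>
        disjoint_family_on (\<lambda>i. set (p i)) {..<3} \<and>
        maximum_matching (complete_on (V - (\<Union>i<3. set (p i)))) M \<and>
        P = \<lparr>verts = V, edges = edges (complete_on V) - (\<Union>i<3. path_edges (p i)) - M\<rparr>)"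

text \<open>\<open>is_G d P G\<close>: the graph \<open>G\<close> consists of a copy \<open>K\<close> of the complete graph on \<open>d - 3\<close>
  vertices, copies \<open>C 0, \<dots>, C (k - 1)\<close> of \<open>P\<close>, and, for each vertex \<open>m\<close> having degree \<open>d - 2\<close> in
  its copy, one edge from \<open>m\<close> to \<open>a m\<close> in \<open>K\<close>.  The vertices \<open>a m\<close> need not be distinct.\<close>

definition is_G :: "nat \<Rightarrow> 'a ugraph \<Rightarrow> 'b ugraph \<Rightarrow> bool" where
  "is_G d P G \<longleftrightarrow>
     (\<exists>K k C a. isomorphic (complete_graph (d - 3)) K \<and>
        (\<forall>i<k::nat. isomorphic P (C i) \<and> verts K \<inter> verts (C i) = {}) \<and>
        disjoint_family_on (\<lambda>i. verts (C i)) {..<k} \<and>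
        (\<forall>i<k. \<forall>m \<in> verts (C i). degree (C i) m = d - 2 \<longrightarrow> a m \<in> verts K) \<and>
        verts G = verts K \<union> (\<Union>i<k. verts (C i)) \<and>
        edges G = edges K \<union> (\<Union>i<k. edges (C i) \<union>
                     {{m, a m} | m. m \<in> verts (C i) \<and> degree (C i) m = d - 2}) \<and>
        (\<forall>v \<in> verts K. degree G v \<ge> d - 1))"

end

theory Submission imports Defs begin

text \<open>Every copy of \<open>P\<^sub>d\<close> is attached to the rest of \<open>G\<close> by three edges only, while separating two
  branch vertices of an immersed \<open>K\<^sub>d\<close> takes at least \<open>d - 1\<close> edges. As the \<open>K\<^sub>d\<^sub>-\<^sub>3\<close> is too small, all
  branch vertices lie in one copy and miss just one of its vertices, \<open>w\<close> say.
  A branch vertex of degree \<open>d - 1\<close> is saturated: each of its edges is used by a path ending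
  there. In particular this holds for the middle vertices other than \<open>w\<close>. The path through the
  attaching edge of such a vertex \<open>m\<close> must come back to the copy through the attaching edge of
  another middle vertex \<open>m'\<close>. If \<open>m' \<noteq> w\<close>, then this is the path joining \<open>m\<close> and \<open>m'\<close>, and by
  saturation it also uses the edge \<open>mm'\<close>, which is impossible. So \<open>m' = w\<close>, for each of at least two
  vertices \<open>m\<close>; hence a single path uses the attaching edges of both, and this was just excluded.\<close>

section \<open>Edge cuts and the paths that cross them\<close>

text \<open>No graph is mentioned: intersecting with \<open>edges G\<close> gives the edge boundary
  of \<open>S\<close> in \<open>G\<close>, and intersecting with \<open>path_edges p\<close> gives
  the crossings of a single path.\<close>

definition cut :: "'a set \<Rightarrow> 'a set set" where
  "cut S = {e. e \<inter> S \<noteq> {} \<and> \<not> e \<subseteq> S}"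

lemma step_change:
  fixes i j :: nat
  assumes "i \<le> j" "Q i \<noteq> Q j"
  shows "\<exists>k. i \<le> k \<and> k < j \<and> Q k \<noteq> Q (Suc k)"
proof (rule ccontr)
  assume neg: "\<not> ?thesis"
  have "Q j = Q i" using assms(1) neg
  proof (induction rule: dec_induct)
    case (step n)
    then show ?case by (metis less_Suc_eq)
  qed simp
  with assms(2) show False by simp
qed

text \<open>A discrete intermediate value argument. The bounds on \<open>k\<close> locate the
  crossing, so that it can later be told apart from another crossing of the same path.\<close>

lemma path_edge_in_cut:
  assumes "i \<le> j" "j < length p" "(p ! i \<in> S) \<noteq> (p ! j \<in> S)"
  shows "\<exists>k. i \<le> k \<and> k < j \<and> {p ! k, p ! Suc k} \<in> path_edges p \<inter> cut S"
proof -
  obtain k where k: "i \<le> k" "k < j" "(p ! k \<in> S) \<noteq> (p ! Suc k \<in> S)"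
    using step_change[of i j "\<lambda>k. p ! k \<in> S"] assms by blast
  then have "{p ! k, p ! Suc k} \<in> path_edges p" "{p ! k, p ! Suc k} \<in> cut S"
    using assms(2) by (auto simp: path_edges_def cut_def)
  with k show ?thesis by blast
qed

lemma path_between_meets_cut:
  assumes "path_between G u v p" "u \<in> S" "v \<notin> S"
  shows "path_edges p \<inter> cut S \<noteq> {}"
proof -
  have ne: "p \<noteq> []" and "{hd p, last p} = {u, v}"
    using assms by (auto simp: path_between_def is_path_def)
  \<comment> \<open>The list may run from \<open>u\<close> to \<open>v\<close> or from
    \<open>v\<close> to \<open>u\<close>, so only the difference in membership of its two ends is
    recorded.\<close>
  then have "(p ! 0 \<in> S) \<noteq> (p ! (length p - 1) \<in> S)"
    using assms(2,3) by (auto simp: hd_conv_nth last_conv_nth doubleton_eq_iff)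
  then show ?thesis
    using path_edge_in_cut[of 0 "length p - 1" p S] ne by (auto simp del: One_nat_def)
qed

text \<open>If \<open>e\<close> leaves \<open>S\<close> in list order, the remainder of the path has
  to re-enter \<open>S\<close>; if \<open>e\<close> enters \<open>S\<close>, the part before it has
  to have left. The second crossing misses the endpoint of \<open>e\<close> inside \<open>S\<close>,
  because a path repeats no vertex, and so it differs from \<open>e\<close>.\<close>

lemma path_between_returns:
  assumes p: "path_between G u v p" and "u \<in> S" "v \<in> S"
    and e: "e \<in> path_edges p" "e \<in> cut S"
  obtains e' where "e' \<in> path_edges p" "e' \<in> cut S" "e' \<noteq> e"
proof -
  have dist: "distinct p" and ne: "p \<noteq> []" and hl: "{hd p, last p} = {u, v}"
    using p by (auto simp: path_between_def is_path_def)
  have ends: "p ! 0 \<in> S" "p ! (length p - 1) \<in> S"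
    using hl assms(2,3) ne by (auto simp: hd_conv_nth last_conv_nth doubleton_eq_iff)
  obtain i where i: "Suc i < length p" "e = {p ! i, p ! Suc i}"
    using e(1) by (auto simp: path_edges_def)
  consider "p ! i \<in> S" "p ! Suc i \<notin> S" | "p ! i \<notin> S" "p ! Suc i \<in> S"
    using e(2) i(2) by (auto simp: cut_def)
  then show thesis
  proof cases
    case 1
    then obtain k where k: "Suc i \<le> k" "k < length p - 1"
        "{p ! k, p ! Suc k} \<in> path_edges p \<inter> cut S"
      using path_edge_in_cut[of "Suc i" "length p - 1" p S] ends i(1) 1 by fastforce
    then have "p ! i \<notin> {p ! k, p ! Suc k}"
      using dist i(1) by (auto simp: nth_eq_iff_index_eq)
    then show thesis using that k(3) i(2) by blast
  next
    case 2
    then obtain k where k: "k < i" "{p ! k, p ! Suc k} \<in> path_edges p \<inter> cut S"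
      using path_edge_in_cut[of 0 i p S] ends i(1) by auto
    then have "p ! Suc i \<notin> {p ! k, p ! Suc k}"
      using dist i(1) by (auto simp: nth_eq_iff_index_eq)
    then show thesis using that k(2) i(2) by blast
  qed
qed

text \<open>Since the ends differ, the path has an edge, and \<open>u\<close> occurs only once, at
  one end of the list. Uniqueness later shows that two edges at \<open>u\<close> on one path
  coincide.\<close>

lemma path_between_end_edge:
  assumes p: "path_between G u v p" and "u \<noteq> v"
  shows "\<exists>!e. e \<in> path_edges p \<and> u \<in> e"
proof -
  have dist: "distinct p" and ne: "p \<noteq> []" and hl: "{hd p, last p} = {u, v}"
    using p by (auto simp: path_between_def is_path_def)
  have len: "length p \<ge> 2"
  proof (rule ccontr)
    assume "\<not> ?thesis"
    moreover have "length p \<noteq> 0" using ne by simp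
    ultimately have "length p = 1" by linarith
    then obtain x where "p = [x]" by (auto simp: length_Suc_conv)
    then have "hd p = last p" by simp
    then show False using hl \<open>u \<noteq> v\<close> by (auto simp: doubleton_eq_iff)
  qed
  consider "u = p ! 0" | "u = p ! (length p - 1)"
    using hl ne by (auto simp: hd_conv_nth last_conv_nth doubleton_eq_iff)
  then show ?thesis
  proof cases
    case 1
    show ?thesis
    proof (rule ex1I[of _ "{p ! 0, p ! Suc 0}"])
      show "{p ! 0, p ! Suc 0} \<in> path_edges p \<and> u \<in> {p ! 0, p ! Suc 0}"
        using 1 len by (auto simp: path_edges_def intro!: exI[of _ 0])
    next
      fix e assume "e \<in> path_edges p \<and> u \<in> e"
      then obtain i where i: "Suc i < length p" "e = {p ! i, p ! Suc i}" "u \<in> e"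
        by (auto simp: path_edges_def)
      then have "p ! 0 = p ! i \<or> p ! 0 = p ! Suc i" using 1 by simp
      then have "i = 0"
        using nth_eq_iff_index_eq[OF dist] i(1) len by fastforce
      with i show "e = {p ! 0, p ! Suc 0}" by simp
    qed
  next
    case 2
    let ?n = "length p - 2"
    have n: "Suc ?n = length p - 1" using len by simp
    show ?thesis
    proof (rule ex1I[of _ "{p ! ?n, p ! Suc ?n}"])
      show "{p ! ?n, p ! Suc ?n} \<in> path_edges p \<and> u \<in> {p ! ?n, p ! Suc ?n}"
        using 2 n len unfolding path_edges_def by auto
    next
      fix e assume "e \<in> path_edges p \<and> u \<in> e"
      then obtain i where i: "Suc i < length p" "e = {p ! i, p ! Suc i}" "u \<in> e"
        by (auto simp: path_edges_def)
      then have "p ! Suc ?n = p ! i \<or> p ! Suc ?n = p ! Suc i" using 2 n by simp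
      then have "Suc ?n = i \<or> Suc ?n = Suc i"
        using nth_eq_iff_index_eq[OF dist, of "Suc ?n"] i(1) n by simp
      then have "i = ?n" using i(1) n by linarith
      with i show "e = {p ! ?n, p ! Suc ?n}" by simp
    qed
  qed
qed

section \<open>Immersions of a complete graph: saturation and small cuts\<close>

locale clique_immersion =
  fixes G :: "'b ugraph" and d :: nat and \<phi> :: "nat \<Rightarrow> 'b" and \<pi> :: "nat set \<Rightarrow> 'b list"
  assumes inj: "inj_on \<phi> {..<d}"
    and paths: "\<And>u v. \<lbrakk>u < d; v < d; u \<noteq> v\<rbrakk> \<Longrightarrow> path_between G (\<phi> u) (\<phi> v) (\<pi> {u, v})"
    and disj: "disjoint_family_on (\<lambda>e. path_edges (\<pi> e)) (edges (complete_graph d))"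
    and finite_edges: "finite (edges G)"
begin

lemma branch_eq_iff: "\<lbrakk>u < d; v < d\<rbrakk> \<Longrightarrow> \<phi> u = \<phi> v \<longleftrightarrow> u = v"
  using inj by (simp add: inj_on_eq_iff)

lemma path_unique:
  assumes "e \<in> path_edges (\<pi> {u, v})" "e \<in> path_edges (\<pi> {x, y})"
    and "u < d" "v < d" "u \<noteq> v" "x < d" "y < d" "x \<noteq> y"
  shows "{u, v} = {x, y}"
proof (rule ccontr)
  assume "{u, v} \<noteq> {x, y}"
  moreover have "{u, v} \<in> edges (complete_graph d)" "{x, y} \<in> edges (complete_graph d)"
    using assms by (auto simp: complete_graph_def complete_on_def)
  ultimately have "path_edges (\<pi> {u, v}) \<inter> path_edges (\<pi> {x, y}) = {}"
    by (intro disjoint_family_onD[OF disj])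
  with assms(1,2) show False by blast
qed

lemma path_edges_subset:
  "\<lbrakk>u < d; v < d; u \<noteq> v\<rbrakk> \<Longrightarrow> path_edges (\<pi> {u, v}) \<subseteq> edges G"
  using paths[of u v] by (simp add: path_between_def is_path_def)

lemma end_edge:
  assumes "u < d" "v < d" "u \<noteq> v"
  shows "\<exists>!e. e \<in> path_edges (\<pi> {u, v}) \<and> \<phi> u \<in> e"
proof -
  have "\<phi> u \<noteq> \<phi> v" using assms by (simp add: branch_eq_iff)
  then show ?thesis by (rule path_between_end_edge[OF paths[OF assms]])
qed

text \<open>The \<open>d - 1\<close> paths ending at \<open>\<phi> u\<close> have pairwise distinct
  end edges there by edge-disjointness. As \<open>\<phi> u\<close> has exactly \<open>d - 1\<close>
  edges, this injection exhausts them.\<close>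

lemma saturated:
  assumes u: "u < d" and deg: "degree G (\<phi> u) = d - 1" and e: "e \<in> edges G" "\<phi> u \<in> e"
  obtains v where "v < d" "v \<noteq> u" "e \<in> path_edges (\<pi> {u, v})"
proof -
  define g where "g v = (THE e. e \<in> path_edges (\<pi> {u, v}) \<and> \<phi> u \<in> e)" for v
  let ?I = "{..<d} - {u}" and ?E = "{e \<in> edges G. \<phi> u \<in> e}"
  have g: "g v \<in> path_edges (\<pi> {u, v}) \<and> \<phi> u \<in> g v" if "v \<in> ?I" for v
    unfolding g_def by (rule theI'[OF end_edge]) (use that u in auto)
  have "g ` ?I \<subseteq> ?E"
  proof (rule image_subsetI)
    fix v assume "v \<in> ?I"
    then show "g v \<in> ?E" using g[of v] path_edges_subset[of u v] u by blast
  qed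
  moreover have "inj_on g ?I"
  proof (rule inj_onI)
    fix v w assume vw: "v \<in> ?I" "w \<in> ?I" "g v = g w"
    then have "{u, v} = {u, w}"
      using g[OF vw(1)] g[OF vw(2)] u by (intro path_unique[of "g v"]) simp_all
    then show "v = w" by (auto simp: doubleton_eq_iff)
  qed
  then have "card (g ` ?I) = card ?E"
    using u deg by (simp add: card_image degree_def)
  ultimately have "g ` ?I = ?E"
    using finite_edges by (intro card_subset_eq) auto
  moreover have "e \<in> ?E" using e by simp
  ultimately obtain v where v: "v \<in> ?I" "e = g v" by (metis (lifting) imageE)
  then show thesis using that[of v] g[OF v(1)] by simp
qed

text \<open>Given branch vertices on both sides, each of the \<open>d - 2\<close> others is joined
  across the cut to one of the two, and edge-disjointness makes the crossings distinct. The path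
  between the two themselves would add one more, but \<open>d - 2\<close> already exceeds the three
  attaching edges.\<close>

lemma branch_vertices_on_one_side:
  assumes small: "card (edges G \<inter> cut S) < d - 2"
  shows "\<phi> ` {..<d} \<subseteq> S \<or> \<phi> ` {..<d} \<inter> S = {}"
proof (rule ccontr)
  assume "\<not> ?thesis"
  then obtain u v where u: "u < d" "\<phi> u \<in> S" and v: "v < d" "\<phi> v \<notin> S" by blast
  \<comment> \<open>The partner of \<open>t\<close> is whichever of \<open>u\<close> and
    \<open>v\<close> lies on the opposite side. As \<open>t\<close> is neither of these two, the
    pair \<open>q t\<close> determines \<open>t\<close>, which gives injectivity of \<open>h\<close>
    below.\<close>
  define q where "q t = (if \<phi> t \<in> S then {t, v} else {t, u})" for t
  let ?I = "{..<d} - {u, v}"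
  have pair: "\<exists>w<d. w \<in> {u, v} \<and> q t = {t, w} \<and> path_edges (\<pi> {t, w}) \<inter> cut S \<noteq> {}" if "t \<in> ?I" for t
  proof (cases "\<phi> t \<in> S")
    case True
    then show ?thesis
      using path_between_meets_cut[OF paths[of t v]] that v by (auto simp: q_def)
  next
    case False
    then show ?thesis
      using path_between_meets_cut[OF paths[of u t]] that u by (auto simp: q_def insert_commute)
  qed
  define h where "h t = (SOME e. e \<in> path_edges (\<pi> (q t)) \<inter> cut S)" for t
  have h: "h t \<in> path_edges (\<pi> (q t)) \<inter> cut S" if "t \<in> ?I" for t
    unfolding h_def using pair[OF that] by (metis some_in_eq)
  have "h ` ?I \<subseteq> edges G \<inter> cut S"
  proof (rule image_subsetI)
    fix t assume t: "t \<in> ?I"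
    then obtain w where "w < d" "w \<in> {u, v}" "q t = {t, w}" using pair by blast
    then show "h t \<in> edges G \<inter> cut S"
      using h[OF t] path_edges_subset[of t w] t by auto
  qed
  moreover have "inj_on h ?I"
  proof (rule inj_onI)
    fix s t assume st: "s \<in> ?I" "t \<in> ?I" "h s = h t"
    obtain x where x: "x < d" "x \<in> {u, v}" "q s = {s, x}" using pair st(1) by blast
    obtain y where y: "y < d" "y \<in> {u, v}" "q t = {t, y}" using pair st(2) by blast
    have "{s, x} = {t, y}"
      using h[OF st(1)] h[OF st(2)] st x y by (intro path_unique[of "h s"]) auto
    then show "s = t" using st x y by (auto simp: doubleton_eq_iff)
  qed
  ultimately have "card ?I \<le> card (edges G \<inter> cut S)"
    using finite_edges by (metis card_image card_mono finite_Int)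
  moreover have "u \<noteq> v" using u v by auto
  then have "card ?I = d - 2"
    using u v by (subst card_Diff_subset) auto
  ultimately show False using small by simp
qed

text \<open>In the application \<open>S\<close> is the vertex set of a copy of
  \<open>P\<^sub>d\<close>, \<open>Y\<close> consists of its three middle vertices, and the edges
  \<open>{m, a m}\<close> attach it to the small complete graph.\<close>

lemma no_concentrated_branch_vertices:
  assumes S: "finite S" "card S = d + 1" "\<phi> ` {..<d} \<subseteq> S"
    and Y: "Y \<subseteq> S" "card Y = 3"
    and cutG: "edges G \<inter> cut S = (\<lambda>m. {m, a m}) ` Y"
    and a: "\<And>m. m \<in> Y \<Longrightarrow> a m \<notin> S"
    and deg: "\<And>m. m \<in> Y \<Longrightarrow> degree G m = d - 1"
    and adj: "\<And>m m'. \<lbrakk>m \<in> Y; m' \<in> Y; m \<noteq> m'\<rbrakk> \<Longrightarrow> {m, m'} \<in> edges G"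
  shows False
proof -
  have attach: "{m, a m} \<in> edges G \<and> {m, a m} \<in> cut S" if "m \<in> Y" for m
    using cutG that by blast
  \<comment> \<open>Every edge at a saturated branch vertex belongs to a path ending there, so by
    edge-disjointness no path has such a vertex in its interior.\<close>
  have end_at: "\<phi> x = m \<or> \<phi> y = m"
    if m: "m \<in> Y" "m \<in> \<phi> ` {..<d}" and "m \<in> e" "e \<in> path_edges (\<pi> {x, y})" "x < d" "y < d" "x \<noteq> y"
    for m e x y
  proof -
    obtain u where u: "u < d" "m = \<phi> u" using m by blast
    have "e \<in> edges G" using that path_edges_subset by blast
    then obtain v where "v < d" "v \<noteq> u" "e \<in> path_edges (\<pi> {u, v})"
      using saturated[OF u(1), of e] deg[OF m(1)] \<open>m \<in> e\<close> u(2) by blast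
    then have "{u, v} = {x, y}" using that u by (intro path_unique[of e]) simp_all
    then show ?thesis using u by (auto simp: doubleton_eq_iff)
  qed
  have not_both: False
    if m: "m \<in> Y" "m \<in> \<phi> ` {..<d}" and m': "m' \<in> Y" "m' \<in> \<phi> ` {..<d}" and "m \<noteq> m'"
      and xy: "x < d" "y < d" "x \<noteq> y"
      and e: "{m, a m} \<in> path_edges (\<pi> {x, y})" "{m', a m'} \<in> path_edges (\<pi> {x, y})"
    for m m' x y
  proof -
    obtain u u' where u: "u < d" "m = \<phi> u" "u' < d" "m' = \<phi> u'" using m m' by blast
    \<comment> \<open>A path touching both \<open>m\<close> and \<open>m'\<close> must end at both,
      so it is the one joining them. This is applied to the two attaching edges and again to the
      edge \<open>{m, m'}\<close>.\<close>
    have ends: "{w, z} = {u, u'}"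
      if "f \<in> path_edges (\<pi> {w, z})" "m \<in> f" "f' \<in> path_edges (\<pi> {w, z})" "m' \<in> f'"
        "w < d" "z < d" "w \<noteq> z" for w z f f'
    proof -
      have "m = \<phi> w \<or> m = \<phi> z" "m' = \<phi> w \<or> m' = \<phi> z"
        using end_at[OF m, of f w z] end_at[OF m', of f' w z] that by auto
      then show ?thesis
        using u \<open>m \<noteq> m'\<close> that(5,6) by (auto simp: branch_eq_iff)
    qed
    have xy': "{x, y} = {u, u'}" using ends[OF e(1) _ e(2)] xy by simp
    obtain v where v: "v < d" "v \<noteq> u" "{m, m'} \<in> path_edges (\<pi> {u, v})"
      using saturated[OF u(1), of "{m, m'}"] deg m(1) u(2) adj[OF m(1) m'(1) \<open>m \<noteq> m'\<close>] by auto
    then have "{u, v} = {u, u'}" using ends[OF v(3) _ v(3)] u by auto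
    then have "{m, m'} \<in> path_edges (\<pi> {u, u'})" "{m, a m} \<in> path_edges (\<pi> {u, u'})"
      using v(3) xy' e(1) by simp_all
    \<comment> \<open>Both edges lie on the path from \<open>m\<close> to \<open>m'\<close>, which
      has only one edge at its end \<open>m\<close>.\<close>
    then have "{m, m'} = {m, a m}"
      using end_edge[of u u'] u \<open>m \<noteq> m'\<close> by auto
    then have "a m = m'" using \<open>m \<noteq> m'\<close> by (auto simp: doubleton_eq_iff)
    then show False using a[OF m(1)] m'(1) Y(1) by auto
  qed
  have "card (S - \<phi> ` {..<d}) = 1"
    using S inj by (simp add: card_Diff_subset card_image)
  then obtain w where w: "S - \<phi> ` {..<d} = {w}" by (auto simp: card_1_singleton_iff)
  \<comment> \<open>Whether \<open>w\<close> lies in \<open>Y\<close> is not assumed: the path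
    returns through an attaching edge of some \<open>m'\<close> in \<open>Y\<close>, and
    \<open>m'\<close> turns out to be \<open>w\<close>.\<close>
  have via_w: "\<exists>x y. x < d \<and> y < d \<and> x \<noteq> y \<and> {m, a m} \<in> path_edges (\<pi> {x, y})
      \<and> {w, a w} \<in> path_edges (\<pi> {x, y})" if m: "m \<in> Y - {w}" for m
  proof -
    have "m \<in> \<phi> ` {..<d}" using m w Y(1) by blast
    then obtain u where u: "u < d" "m = \<phi> u" by blast
    obtain v where v: "v < d" "v \<noteq> u" "{m, a m} \<in> path_edges (\<pi> {u, v})"
      using saturated[OF u(1), of "{m, a m}"] deg attach m u by auto
    have "\<phi> u \<in> S" "\<phi> v \<in> S" using S(3) u v by auto
    then obtain f where f: "f \<in> path_edges (\<pi> {u, v})" "f \<in> cut S" "f \<noteq> {m, a m}"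
      using path_between_returns[OF paths[of u v] _ _ v(3)] attach m u v by blast
    then have "f \<in> edges G \<inter> cut S"
      using path_edges_subset[of u v] u v by blast
    then obtain m' where m': "m' \<in> Y" "f = {m', a m'}" using cutG by auto
    then have "m' \<noteq> m" using f by auto
    then have "m' \<notin> \<phi> ` {..<d}"
      using not_both[of m m' u v] m m' f v u \<open>m \<in> \<phi> ` {..<d}\<close> by auto
    then have "m' = w" using w m'(1) Y(1) by blast
    then show ?thesis using v f m' u by auto
  qed
  have "card (Y - {w}) \<ge> 2" using Y(2) card_Diff_singleton_if[of Y w] by auto
  then obtain m m' where mm: "m \<in> Y - {w}" "m' \<in> Y - {w}" "m \<noteq> m'"
    by (metis card_le_Suc0_iff_eq card.infinite not_less_eq_eq numeral_2_eq_2 zero_le)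
  obtain x y where xy: "x < d" "y < d" "x \<noteq> y" "{m, a m} \<in> path_edges (\<pi> {x, y})"
      "{w, a w} \<in> path_edges (\<pi> {x, y})" using via_w[OF mm(1)] by blast
  obtain x' y' where xy': "x' < d" "y' < d" "x' \<noteq> y'" "{m', a m'} \<in> path_edges (\<pi> {x', y'})"
      "{w, a w} \<in> path_edges (\<pi> {x', y'})" using via_w[OF mm(2)] by blast
  \<comment> \<open>Both paths contain \<open>{w, a w}\<close>, so they are the same path, which
    then uses the attaching edges of two branch vertices in \<open>Y\<close>.\<close>
  have "{x, y} = {x', y'}" using path_unique[OF xy(5) xy'(5)] xy xy' by blast
  then show False
    using not_both[of m m' x y] mm xy xy'(4) w Y(1) by auto
qed

end

section \<open>The graph \<open>P\<^sub>d\<close> and its isomorphic copies\<close>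

text \<open>In \<open>P\<^sub>d\<close> these are the middle vertices of the deleted paths; in a
  copy inside \<open>G\<close> they carry the attaching edges.\<close>

definition deficient :: "nat \<Rightarrow> 'a ugraph \<Rightarrow> 'a set" where
  "deficient d P = {v \<in> verts P. degree P v = d - 2}"

text \<open>The features of \<open>P\<^sub>d\<close> on which the argument rests, in a form that
  transfers along isomorphisms.\<close>

definition gadget :: "nat \<Rightarrow> 'a ugraph \<Rightarrow> bool" where
  "gadget d P \<longleftrightarrow> finite (verts P) \<and> card (verts P) = d + 1 \<and> edges P \<subseteq> Pow (verts P) \<and>
     (\<forall>v\<in>verts P. d - 2 \<le> degree P v) \<and> card (deficient d P) = 3 \<and>
     (\<forall>m\<in>deficient d P. \<forall>m'\<in>deficient d P. m \<noteq> m' \<longrightarrow> {m, m'} \<in> edges P)"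

lemma degree_image:
  assumes f: "inj_on f (verts H)" and "edges H \<subseteq> Pow (verts H)"
    and E: "edges H' = (\<lambda>e. f ` e) ` edges H" and v: "v \<in> verts H"
  shows "degree H' (f v) = degree H v"
proof -
  have "{e \<in> edges H'. f v \<in> e} = (\<lambda>e. f ` e) ` {e \<in> edges H. v \<in> e}"
    using assms by (auto dest: inj_onD)
  moreover have "inj_on (\<lambda>e. f ` e) {e \<in> edges H. v \<in> e}"
    by (rule inj_on_subset[OF inj_on_image_Pow[OF f]]) (use assms(2) in auto)
  ultimately show ?thesis by (simp add: degree_def card_image)
qed

lemma gadget_isomorphic:
  assumes g: "gadget d P" and "isomorphic P C"
  shows "gadget d C"
proof -
  obtain f where f: "bij_betw f (verts P) (verts C)" and E: "edges C = (\<lambda>e. f ` e) ` edges P"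
    using assms by (auto simp: isomorphic_def)
  have inj: "inj_on f (verts P)" and V: "verts C = f ` verts P"
    using f by (auto simp: bij_betw_def)
  have PE: "edges P \<subseteq> Pow (verts P)" using g by (simp add: gadget_def)
  note deg = degree_image[OF inj PE E]
  have def: "deficient d C = f ` deficient d P"
    by (auto simp: deficient_def V deg)
  have "inj_on f (deficient d P)" using inj by (auto simp: deficient_def inj_on_def)
  then have "card (deficient d C) = 3"
    using g def by (simp add: card_image gadget_def)
  moreover have "card (verts C) = d + 1" "finite (verts C)"
    using g V inj by (simp_all add: card_image gadget_def)
  moreover have "edges C \<subseteq> Pow (verts C)" unfolding E V using PE by blast
  moreover have "\<forall>v\<in>verts C. d - 2 \<le> degree C v" using g V deg by (auto simp: gadget_def)
  moreover have "{m, m'} \<in> edges C"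
    if mm: "m \<in> deficient d C" "m' \<in> deficient d C" "m \<noteq> m'" for m m'
  proof -
    obtain x x' where x: "x \<in> deficient d P" "x' \<in> deficient d P" "m = f x" "m' = f x'"
      using mm(1,2) def by auto
    then have "{x, x'} \<in> edges P" using g mm(3) by (auto simp: gadget_def)
    then have "f ` {x, x'} \<in> edges C" using E by blast
    then show ?thesis using x by simp
  qed
  ultimately show ?thesis by (simp add: gadget_def)
qed

lemma degree_complete_on_minus:
  assumes "finite V" "v \<in> V" "D \<subseteq> edges (complete_on V)"
  shows "degree \<lparr>verts = V, edges = edges (complete_on V) - D\<rparr> v = card V - 1 - card {e \<in> D. v \<in> e}"
proof -
  have "{e \<in> edges (complete_on V). v \<in> e} = (\<lambda>u. {v, u}) ` (V - {v})"
    using assms(2) by (auto simp: complete_on_def)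
  moreover have "inj_on (\<lambda>u. {v, u}) (V - {v})"
    by (auto simp: inj_on_def doubleton_eq_iff)
  ultimately have c: "card {e \<in> edges (complete_on V). v \<in> e} = card V - 1"
    and fin: "finite {e \<in> edges (complete_on V). v \<in> e}"
    using assms(1,2) by (simp_all add: card_image)
  have sub: "{e \<in> D. v \<in> e} \<subseteq> {e \<in> edges (complete_on V). v \<in> e}" using assms(3) by auto
  have "{e \<in> edges (complete_on V) - D. v \<in> e} =
      {e \<in> edges (complete_on V). v \<in> e} - {e \<in> D. v \<in> e}" by auto
  then show ?thesis
    using c sub fin by (simp add: degree_def card_Diff_subset finite_subset)
qed

lemma path_edges_three: "path_edges [x, y, z] = {{x, y}, {y, z}}"
proof -
  have "Suc i < length [x, y, z] \<longleftrightarrow> i = 0 \<or> i = 1" for i by auto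
  then have "path_edges [x, y, z] = {{[x, y, z] ! i, [x, y, z] ! Suc i} | i. i = 0 \<or> i = 1}"
    unfolding path_edges_def by presburger
  also have "\<dots> = {{x, y}, {y, z}}" by (auto intro: exI[of _ 0] exI[of _ 1])
  finally show ?thesis .
qed

text \<open>The deleted edges \<open>D\<close> meet a middle vertex \<open>y i\<close> twice and any
  other vertex at most once, which identifies the deficient vertices. Two middle vertices stay
  adjacent because a deleted edge lies within a single path or avoids all three.\<close>

lemma gadget_is_P:
  assumes d: "d \<ge> 8" and "is_P d P"
  shows "gadget d P"
proof -
  obtain V p M where V: "finite V" "card V = d + 1"
    and p: "\<And>i. i < (3::nat) \<Longrightarrow> is_path (complete_on V) (p i) \<and> length (p i) = 3"
    and disj: "disjoint_family_on (\<lambda>i. set (p i)) {..<3}"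
    and M: "maximum_matching (complete_on (V - (\<Union>i<3. set (p i)))) M"
    and P: "P = \<lparr>verts = V, edges = edges (complete_on V) - (\<Union>i<3. path_edges (p i)) - M\<rparr>"
    using assms(2) by (auto simp: is_P_def)
  define x y z where "x i = p i ! 0" and "y i = p i ! 1" and "z i = p i ! 2" for i
  have pi: "p i = [x i, y i, z i]" if "i < 3" for i
    using p[OF that] by (auto simp: x_def y_def z_def numeral_3_eq_3 length_Suc_conv)
  have dist: "distinct [x i, y i, z i]" and inV: "{x i, y i, z i} \<subseteq> V" if "i < 3" for i
    using p[OF that] pi[OF that] by (auto simp: is_path_def complete_on_def)
  have sets: "set (p i) = {x i, y i, z i}" if "i < 3" for i using pi[OF that] by simp
  have apart: "{x i, y i, z i} \<inter> {x j, y j, z j} = {}" if "i < 3" "j < 3" "i \<noteq> j" for i j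
    using that sets disjoint_family_onD[OF disj, of i j] by simp
  have pe: "path_edges (p i) = {{x i, y i}, {y i, z i}}" if "i < 3" for i
    by (simp only: pi[OF that] path_edges_three)
  let ?U = "\<Union>i<3. {x i, y i, z i}"
  have M': "M \<subseteq> edges (complete_on (V - ?U))" "disjoint M"
    using M sets by (simp_all add: maximum_matching_def matching_def)
  then have Msub: "M \<subseteq> Pow (V - ?U)" by (auto simp: complete_on_def)
  define D where "D = (\<Union>i<3. path_edges (p i)) \<union> M"
  have "path_edges (p i) \<subseteq> edges (complete_on V)" if "i < 3" for i
    using p[OF that] by (simp add: is_path_def)
  moreover have "edges (complete_on (V - ?U)) \<subseteq> edges (complete_on V)"
    by (auto simp: complete_on_def)
  ultimately have D: "D \<subseteq> edges (complete_on V)" using M'(1) unfolding D_def by blast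
  have P': "P = \<lparr>verts = V, edges = edges (complete_on V) - D\<rparr>"
    using P by (simp add: D_def Diff_eq Int_assoc)
  have deg: "degree P v = d - card {e \<in> D. v \<in> e}" if "v \<in> V" for v
    using degree_complete_on_minus[OF V(1) that D] V(2) P' by simp
  have De: "e \<in> D \<longleftrightarrow> e \<in> M \<or> (\<exists>i<3. e = {x i, y i} \<or> e = {y i, z i})" for e
    using pe by (auto simp: D_def)
  have mid: "card {e \<in> D. y i \<in> e} = 2" if i: "i < 3" for i
  proof -
    have "{e \<in> D. y i \<in> e} = {{x i, y i}, {y i, z i}}"
    proof -
      have "e = {x i, y i} \<or> e = {y i, z i}" if e: "e \<in> D" "y i \<in> e" for e
      proof -
        have "e \<notin> M" using Msub e(2) i by auto
        then obtain j where "j < 3" "e = {x j, y j} \<or> e = {y j, z j}" using e De by blast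
        moreover from this have "j = i" using apart[OF i, of j] e(2) by blast
        ultimately show ?thesis by blast
      qed
      then show ?thesis using i De by blast
    qed
    moreover have "{x i, y i} \<noteq> {y i, z i}" using dist[OF i] by (auto simp: doubleton_eq_iff)
    ultimately show ?thesis by simp
  qed
  have other: "card {e \<in> D. v \<in> e} \<le> 1" if v: "v \<notin> y ` {..<3}" for v
  proof -
    have "e = e'" if e: "e \<in> D" "v \<in> e" and e': "e' \<in> D" "v \<in> e'" for e e'
    proof (cases "v \<in> ?U")
      case True
      then have "e \<notin> M" "e' \<notin> M" using Msub e(2) e'(2) by blast+
      then obtain i j where i: "i < 3" "e = {x i, y i} \<or> e = {y i, z i}"
        and j: "j < 3" "e' = {x j, y j} \<or> e' = {y j, z j}"
        using e(1) e'(1) De[of e] De[of e'] by metis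
      have "v \<in> {x i, y i, z i} \<inter> {x j, y j, z j}" using i(2) j(2) e(2) e'(2) by auto
      then have "i = j" using apart[OF i(1) j(1)] by (cases "i = j") simp_all
      moreover have "v \<noteq> y i" using v i by auto
      \<comment> \<open>The two edges of a deleted path share only its middle vertex, so any other
        vertex \<open>v\<close> of that path determines which of them contains it.\<close>
      ultimately have "f = (if v = x i then {x i, y i} else {y i, z i})" if "f = e \<or> f = e'" for f
        using that i(2) j(2) e(2) e'(2) dist[OF i(1)] by auto
      then show ?thesis by metis
    next
      case False
      then have "e \<in> M" "e' \<in> M" using e e' De[of e] De[of e'] by auto
      then show ?thesis using disjointD[OF M'(2), of e e'] e(2) e'(2) by blast
    qed
    then have "\<forall>e\<in>{e \<in> D. v \<in> e}. \<forall>e'\<in>{e \<in> D. v \<in> e}. e = e'" by blast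
    moreover have "D \<subseteq> Pow V" using D by (auto simp: complete_on_def)
    then have "finite {e \<in> D. v \<in> e}" using V(1) by (simp add: finite_subset)
    ultimately show ?thesis by (simp only: One_nat_def card_le_Suc0_iff_eq)
  qed
  have yV: "y ` {..<3} \<subseteq> V" using inV by auto
  have "deficient d P = y ` {..<3}"
  proof -
    have "degree P v = d - 2 \<longleftrightarrow> v \<in> y ` {..<3}" if "v \<in> V" for v
    proof (cases "v \<in> y ` {..<3}")
      case True
      then have "card {e \<in> D. v \<in> e} = 2" using mid by blast
      with True show ?thesis using deg[OF that] by simp
    next
      case False
      with other[OF False] show ?thesis using deg[OF that] d by simp
    qed
    then show ?thesis using yV P by (auto simp: deficient_def)
  qed
  moreover have "inj_on y {..<3}"
  proof (rule inj_onI)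
    fix i j :: nat assume "i \<in> {..<3}" "j \<in> {..<3}" "y i = y j"
    then show "i = j" using apart[of i j] by fastforce
  qed
  moreover have "{y i, y j} \<in> edges P" if ij: "i < 3" "j < 3" "i \<noteq> j" for i j
  proof -
    have "{y i, y j} \<notin> M" using Msub ij by auto
    moreover have "{y i, y j} \<noteq> {x k, y k} \<and> {y i, y j} \<noteq> {y k, z k}" if "k < 3" for k
    proof -
      have "\<not> {y i, y j} \<subseteq> {x k, y k, z k}"
        using apart[of i k] apart[of j k] ij that by (cases "i = k") auto
      then show ?thesis by auto
    qed
    ultimately have "{y i, y j} \<notin> D" using De by auto
    moreover have "{y i, y j} \<in> edges (complete_on V)"
      using yV ij apart[OF ij] by (fastforce simp: complete_on_def)
    ultimately show ?thesis by (simp add: P')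
  qed
  moreover have "d - 2 \<le> degree P v" if "v \<in> V" for v
  proof -
    have "card {e \<in> D. v \<in> e} \<le> 2"
    proof (cases "v \<in> y ` {..<3}")
      case True
      then have "card {e \<in> D. v \<in> e} = 2" using mid by blast
      then show ?thesis by simp
    next
      case False
      from other[OF False] show ?thesis by simp
    qed
    then show ?thesis using deg[OF that] by simp
  qed
  moreover have "edges P \<subseteq> Pow (verts P)" by (auto simp: P complete_on_def)
  ultimately show ?thesis using V by (auto simp: gadget_def card_image P)
qed

section \<open>Minimum degree and non-immersion for the assembled graph\<close>

theorem theorem4p9:
  fixes d :: nat and P :: "'a ugraph" and G :: "'b ugraph"
  assumes "d \<ge> 8"
    and "is_P d P"
    and "is_G d P G"
  shows "min_degree G = d - 1 \<and> \<not> immersed (complete_graph d) G"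
proof -
  obtain K k C a where iK: "isomorphic (complete_graph (d - 3)) K"
    and C': "\<forall>i<k::nat. isomorphic P (C i) \<and> verts K \<inter> verts (C i) = {}"
    and disj: "disjoint_family_on (\<lambda>i. verts (C i)) {..<k}"
    and a': "\<forall>i<k. \<forall>m \<in> verts (C i). degree (C i) m = d - 2 \<longrightarrow> a m \<in> verts K"
    and VG: "verts G = verts K \<union> (\<Union>i<k. verts (C i))"
    and EG': "edges G = edges K \<union> (\<Union>i<k. edges (C i) \<union>
                     {{m, a m} | m. m \<in> verts (C i) \<and> degree (C i) m = d - 2})"
    and degK: "\<forall>v \<in> verts K. degree G v \<ge> d - 1"
    using assms(3) unfolding is_G_def by (elim exE conjE) (rule that; assumption)
  have C: "isomorphic P (C i)" "verts K \<inter> verts (C i) = {}" if "i < k" for i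
    using C' that by simp_all
  let ?Y = "\<lambda>i. deficient d (C i)"
  have EG: "edges G = edges K \<union> (\<Union>i<k. edges (C i) \<union> (\<lambda>m. {m, a m}) ` ?Y i)"
    unfolding EG' deficient_def by auto
  have a: "a m \<in> verts K" if "i < k" "m \<in> ?Y i" for i m
    using a' that by (simp add: deficient_def)
  have gad: "gadget d (C i)" if "i < k" for i
    using gadget_isomorphic[OF gadget_is_P[OF assms(1,2)] C(1)[OF that]] .
  have CE: "edges (C i) \<subseteq> Pow (verts (C i))" and Cfin: "finite (verts (C i))"
    and Ccard: "card (verts (C i)) = d + 1" and Ycard: "card (?Y i) = 3"
    and Ysub: "?Y i \<subseteq> verts (C i)" if "i < k" for i
    using gad[OF that] by (auto simp: gadget_def deficient_def)
  have sep: "verts (C i) \<inter> verts (C j) = {}" if "i < k" "j < k" "i \<noteq> j" for i j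
    using disjoint_family_onD[OF disj, of i j] that by simp
  have KE: "edges K \<subseteq> Pow (verts K)" and Kfin: "finite (verts K)" and Kcard: "card (verts K) = d - 3"
  proof -
    obtain f where f: "bij_betw f {..<d - 3} (verts K)"
      and E: "edges K = (\<lambda>e. f ` e) ` edges (complete_graph (d - 3))"
      using iK by (auto simp: isomorphic_def complete_graph_def complete_on_def)
    show "edges K \<subseteq> Pow (verts K)"
      using f E by (auto simp: bij_betw_def complete_graph_def complete_on_def)
    show "finite (verts K)" using bij_betw_finite[OF f] by simp
    show "card (verts K) = d - 3" using bij_betw_same_card[OF f] by simp
  qed
  have Gfin: "finite (verts G)" using VG Kfin Cfin by auto
  have "edges (C i) \<union> (\<lambda>m. {m, a m}) ` ?Y i \<subseteq> Pow (verts (C i) \<union> verts K)" if "i < k" for i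
    using CE[OF that] Ysub[OF that] a[OF that] by blast
  then have "edges G \<subseteq> Pow (verts G)"
    unfolding EG VG using KE by blast
  then have GEfin: "finite (edges G)" using Gfin finite_subset by blast
  \<comment> \<open>A vertex of a copy meets only edges of that copy and, if it is deficient, its
    own attaching edge. Both the degrees and the cuts of copies are read off from this.\<close>
  have at_copy: "{e \<in> edges G. v \<in> e} =
      {e \<in> edges (C i). v \<in> e} \<union> (if v \<in> ?Y i then {{v, a v}} else {})"
    if i: "i < k" and v: "v \<in> verts (C i)" for i v
  proof (intro equalityI subsetI)
    fix e assume e: "e \<in> {e \<in> edges G. v \<in> e}"
    have vK: "v \<notin> verts K" using C(2)[OF i] v by blast
    then have "e \<notin> edges K" using e KE by blast
    then obtain j where j: "j < k" "e \<in> edges (C j) \<union> (\<lambda>m. {m, a m}) ` ?Y j"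
      using e EG by blast
    have "v \<in> verts (C j)"
      using j e CE[OF j(1)] Ysub[OF j(1)] a[OF j(1)] vK by auto
    then have "j = i" using sep[OF i j(1)] v by blast
    then show "e \<in> {e \<in> edges (C i). v \<in> e} \<union> (if v \<in> ?Y i then {{v, a v}} else {})"
      using j e a[OF j(1)] vK by auto
  next
    fix e assume "e \<in> {e \<in> edges (C i). v \<in> e} \<union> (if v \<in> ?Y i then {{v, a v}} else {})"
    then show "e \<in> {e \<in> edges G. v \<in> e}"
      using EG i by (auto split: if_splits)
  qed
  have deg: "degree G v = degree (C i) v + (if v \<in> ?Y i then 1 else 0)"
    if i: "i < k" and v: "v \<in> verts (C i)" for i v
  proof -
    have "finite (edges (C i))" using CE[OF i] Cfin[OF i] finite_subset by blast
    moreover have "{v, a v} \<notin> edges (C i)" if "v \<in> ?Y i"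
      using CE[OF i] a[OF i that] C(2)[OF i] by blast
    ultimately show ?thesis by (simp add: degree_def at_copy[OF i v])
  qed
  have degY: "degree G m = d - 1" if "i < k" "m \<in> ?Y i" for i m
    using deg[of i m] that assms(1) by (simp add: deficient_def)
  have degC: "degree G v \<ge> d - 1" if i: "i < k" and v: "v \<in> verts (C i)" for i v
  proof -
    have "d - 2 \<le> degree (C i) v" using gad[OF i] v by (simp add: gadget_def)
    then show ?thesis using deg[OF i v] v by (auto simp: deficient_def)
  qed
  \<comment> \<open>A copy is needed for the value \<open>d - 1\<close> to be attained. Without
    copies \<open>G\<close> would be the complete graph on \<open>d - 3\<close> vertices, whose
    degrees \<open>d - 4\<close> violate the degree condition on \<open>K\<close>.\<close>
  have "k > 0"
  proof (rule ccontr)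
    assume "\<not> k > 0"
    then have GK: "edges G = edges K" using EG by simp
    obtain f where f: "bij_betw f (verts (complete_graph (d - 3))) (verts K)"
      and E: "edges K = (\<lambda>e. f ` e) ` edges (complete_graph (d - 3))"
      using iK by (auto simp: isomorphic_def)
    have V: "verts (complete_graph (d - 3)) = {..<d - 3}"
      by (simp add: complete_graph_def complete_on_def)
    have "0 \<in> {..<d - 3}" using assms(1) by simp
    then have "degree K (f 0) = degree (complete_graph (d - 3)) 0"
      using degree_image[of f "complete_graph (d - 3)" K 0] f E V
      by (auto simp: bij_betw_def complete_graph_def complete_on_def)
    also have "\<dots> = d - 3 - 1"
      using degree_complete_on_minus[of "{..<d - 3}" 0 "{}"] assms(1)
      by (simp add: complete_graph_def degree_def)
    finally have "degree G (f 0) = d - 3 - 1" using GK by (simp add: degree_def)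
    moreover have "f 0 \<in> verts K" using f V \<open>0 \<in> {..<d - 3}\<close> by (auto simp: bij_betw_def)
    ultimately show False using degK assms(1) by fastforce
  qed
  have "min_degree G = d - 1"
    unfolding min_degree_def
  proof (rule Min_eqI)
    show "finite (degree G ` verts G)" using Gfin by simp
    show "d - 1 \<le> n" if "n \<in> degree G ` verts G" for n
      using that VG degK degC by auto
    have "?Y 0 \<noteq> {}" using Ycard[OF \<open>k > 0\<close>] by auto
    then obtain m where "m \<in> ?Y 0" by blast
    then show "d - 1 \<in> degree G ` verts G"
      using degY[OF \<open>k > 0\<close>] Ysub[OF \<open>k > 0\<close>] VG \<open>k > 0\<close> by (metis UN_I UnCI image_eqI lessThan_iff subsetD)
  qed
  moreover have "\<not> immersed (complete_graph d) G"
  proof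
    assume "immersed (complete_graph d) G"
    then obtain \<phi> \<pi> where inj: "inj_on \<phi> {..<d}" and sub: "\<phi> ` {..<d} \<subseteq> verts G"
      and paths: "\<forall>u v. {u, v} \<in> edges (complete_graph d) \<longrightarrow>
        path_between G (\<phi> u) (\<phi> v) (\<pi> {u, v})"
      and dj: "disjoint_family_on (\<lambda>e. path_edges (\<pi> e)) (edges (complete_graph d))"
      by (auto simp: immersed_def complete_graph_def complete_on_def)
    interpret clique_immersion G d \<phi> \<pi>
    proof
      show "path_between G (\<phi> u) (\<phi> v) (\<pi> {u, v})" if "u < d" "v < d" "u \<noteq> v" for u v
        using paths that by (auto simp: complete_graph_def complete_on_def)
    qed (use inj dj GEfin in auto)
    have cutG: "edges G \<inter> cut (verts (C i)) = (\<lambda>m. {m, a m}) ` ?Y i" if i: "i < k" for i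
    proof (intro equalityI subsetI)
      fix e assume e: "e \<in> edges G \<inter> cut (verts (C i))"
      then obtain v where "v \<in> verts (C i)" "v \<in> e" by (auto simp: cut_def)
      moreover have "e \<notin> edges (C i)" using e CE[OF i] by (auto simp: cut_def)
      ultimately show "e \<in> (\<lambda>m. {m, a m}) ` ?Y i"
        using at_copy[OF i, of v] e by (auto split: if_splits)
    next
      fix e assume "e \<in> (\<lambda>m. {m, a m}) ` ?Y i"
      then show "e \<in> edges G \<inter> cut (verts (C i))"
        using EG i a[OF i] Ysub[OF i] C(2)[OF i] by (fastforce simp: cut_def)
    qed
    show False
    proof (cases "\<exists>i<k. \<phi> ` {..<d} \<subseteq> verts (C i)")
      case True
      then obtain i where i: "i < k" "\<phi> ` {..<d} \<subseteq> verts (C i)" by blast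
      show False
      proof (rule no_concentrated_branch_vertices[OF Cfin Ccard i(2) Ysub Ycard cutG])
        show "a m \<notin> verts (C i)" if "m \<in> ?Y i" for m using a[OF i(1) that] C(2)[OF i(1)] by blast
        show "{m, m'} \<in> edges G" if "m \<in> ?Y i" "m' \<in> ?Y i" "m \<noteq> m'" for m m'
        proof -
          have "{m, m'} \<in> edges (C i)" using gad[OF i(1)] that by (simp add: gadget_def)
          then show ?thesis using EG i(1) by blast
        qed
      qed (use i degY in auto)
    next
      case False
      have "\<phi> ` {..<d} \<inter> verts (C i) = {}" if i: "i < k" for i
      proof -
        \<comment> \<open>An infinite set would have cardinality 0, not 3.\<close>
        have "finite (?Y i)" using Ycard[OF i] card.infinite by fastforce
        then have "card (edges G \<inter> cut (verts (C i))) \<le> 3"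
          using cutG[OF i] Ycard[OF i] card_image_le by metis
        then show ?thesis using branch_vertices_on_one_side[of "verts (C i)"] False i assms(1) by auto
      qed
      \<comment> \<open>Every copy is cut off by at most three edges and 3 < \<open>d - 2\<close>,
        so a copy not containing all branch vertices contains none. They would all have to fit among
        the \<open>d - 3\<close> vertices of \<open>K\<close>.\<close>
      then have "\<phi> ` {..<d} \<subseteq> verts K" using sub VG by blast
      then have "d \<le> d - 3"
        using card_mono[OF Kfin] Kcard inj by (metis card_image card_lessThan)
      then show False using assms(1) by simp
    qed
  qed
  ultimately show ?thesis ..
qed

end
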